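(* Let $\Gamma$ be an orientable pure abstract simplicial complex of dimension $d$ on the vertex set $[n]$. If $\Gamma$ is balanced then $\Gamma$ is positively decorable, and if $\Gamma$ is positively decorable then $\Gamma$ is bipartite.
   Context: A pure abstract simplicial complex of dimension $d$ on $n$ vertices (an $(n,d)$-complex) is a finite set $\Gamma$ of subsets of $[n]=\{1,\dots,n\}$ of cardinality $d+1$, called facets; an edge of $\Gamma$ is a 2-element subset of a facet. Balanced: there is a map $\gamma:[n]\to[d+1]$ with $\gamma(a)\ne\gamma(b)$ for every edge $\{a,b\}$ of $\Gamma$. Positively decorable: there is a real $d\times n$ matrix $C$ such that for every facet $\tau\in\Gamma$ the $d\times(d+1)$ submatrix $C_\tau$ formed by the columns indexed by $\tau$ is positively spanning. A $d\times(d+1)$ real matrix $M$ is positively spanning if all the values $(-1)^i\,\mathrm{minor}(M,i)$, $1\le i\le d+1$, are nonzero and have the same sign, where $\mathrm{minor}(M,i)$ is the determinant of $M$ with its $i$-th column removed. Bipartite: the adjacency graph of $\Gamma$ is bipartite, where the adjacency graph has the facets of $\Gamma$ as vertices, two facets being adjacent if they share exactly $d$ vertices. Orientable: an orientation of a $d$-simplex is a choice of calling "positive" one of the two classes modulo even permutations of orderings of its vertices and "negative" the other. Orientations of two $d$-simplices $\tau,\tau'$ with $d$ common vertices are consistent if replacing, in a positive ordering of $\tau$, the vertex of $\tau\setminus\tau'$ by the vertex of $\tau'\setminus\tau$ yields a negative ordering of $\tau'$. $\Gamma$ is orientable if its facets can be oriented so that the orientations of every two adjacent facets are consistent. *)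

theory Defs
  imports
    Complex_Main
    "HOL-Combinatorics.Permutations"
    "HOL-Combinatorics.Multiset_Permutations"
    "Jordan_Normal_Form.Determinant"
    "Jordan_Normal_Form.DL_Submatrix"
begin

definition pure_complex :: "nat \<Rightarrow> nat \<Rightarrow> nat set set \<Rightarrow> bool" where
  "pure_complex n d \<Gamma> \<longleftrightarrow> finite \<Gamma> \<and> (\<forall>\<tau>\<in>\<Gamma>. \<tau> \<subseteq> {1..n} \<and> card \<tau> = d + 1)"

definition edges :: "nat set set \<Rightarrow> nat set set" where
  "edges \<Gamma> = {e. card e = 2 \<and> (\<exists>\<tau>\<in>\<Gamma>. e \<subseteq> \<tau>)}"

definition balanced :: "nat \<Rightarrow> nat \<Rightarrow> nat set set \<Rightarrow> bool" where
  "balanced n d \<Gamma> \<longleftrightarrow>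
     (\<exists>\<gamma>. \<gamma> ` {1..n} \<subseteq> {1..d + 1} \<and> (\<forall>a b. {a, b} \<in> edges \<Gamma> \<longrightarrow> \<gamma> a \<noteq> \<gamma> b))"

text \<open>
  Matrix columns are numbered from 1 here, whereas the index sets passed to \<^const>\<open>submatrix\<close>
  number them from 0; hence the occurrences of \<^const>\<open>Suc\<close>.
\<close>

definition minor :: "real mat \<Rightarrow> nat \<Rightarrow> real" where
  "minor M i = det (submatrix M UNIV {j. Suc j \<noteq> i})"

definition positively_spanning :: "nat \<Rightarrow> real mat \<Rightarrow> bool" where
  "positively_spanning d M \<longleftrightarrow> M \<in> carrier_mat d (d + 1) \<and>
     (\<forall>i\<in>{1..d + 1}. (-1) ^ i * minor M i \<noteq> 0) \<and>
     (\<forall>i\<in>{1..d + 1}. \<forall>j\<in>{1..d + 1}.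
        sgn ((-1) ^ i * minor M i) = sgn ((-1) ^ j * minor M j))"

definition column_submatrix :: "real mat \<Rightarrow> nat set \<Rightarrow> real mat" where
  "column_submatrix C \<tau> = submatrix C UNIV {j. Suc j \<in> \<tau>}"

definition positively_decorable :: "nat \<Rightarrow> nat \<Rightarrow> nat set set \<Rightarrow> bool" where
  "positively_decorable n d \<Gamma> \<longleftrightarrow>
     (\<exists>C \<in> carrier_mat d n. \<forall>\<tau>\<in>\<Gamma>. positively_spanning d (column_submatrix C \<tau>))"

definition adjacent :: "nat \<Rightarrow> nat set \<Rightarrow> nat set \<Rightarrow> bool" where
  "adjacent d \<tau> \<tau>' \<longleftrightarrow> card (\<tau> \<inter> \<tau>') = d"

definition adjacency_edges :: "nat \<Rightarrow> nat set set \<Rightarrow> nat set set set" where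
  "adjacency_edges d \<Gamma> = {{\<tau>, \<tau>'} | \<tau> \<tau>'. \<tau> \<in> \<Gamma> \<and> \<tau>' \<in> \<Gamma> \<and> adjacent d \<tau> \<tau>'}"

definition bipartite_graph :: "'v set \<Rightarrow> 'v set set \<Rightarrow> bool" where
  "bipartite_graph V E \<longleftrightarrow>
     (\<exists>A B. A \<union> B = V \<and> A \<inter> B = {} \<and> (\<forall>e\<in>E. \<exists>a\<in>A. \<exists>b\<in>B. e = {a, b}))"

definition bipartite :: "nat \<Rightarrow> nat set set \<Rightarrow> bool" where
  "bipartite d \<Gamma> \<longleftrightarrow> bipartite_graph \<Gamma> (adjacency_edges d \<Gamma>)"

text \<open>
  An orientation of a simplex \<open>\<tau>\<close> is represented by the set \<open>P\<close> of its positive orderings: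
  even permutations preserve membership in \<open>P\<close> and odd ones reverse it. When \<open>\<tau>\<close> has at least
  two vertices, this says exactly that \<open>P\<close> is one of the two classes of orderings modulo even
  permutations. When \<open>\<tau>\<close> is a single vertex \<open>a\<close>, the two classes are taken to be \<open>{[a]}\<close> and the
  empty set, so that an orientation is the usual choice of a sign for the vertex.
\<close>

definition orientation :: "nat set \<Rightarrow> nat list set \<Rightarrow> bool" where
  "orientation \<tau> P \<longleftrightarrow> P \<subseteq> permutations_of_set \<tau> \<and>
     (\<forall>xs \<in> permutations_of_set \<tau>. \<forall>p. p permutes {..<length xs} \<longrightarrow>
        (permute_list p xs \<in> P \<longleftrightarrow> (xs \<in> P \<longleftrightarrow> evenperm p)))"

text \<open>
  Replacing a vertex has to turn positive orderings into negative ones and negative orderings into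
  positive ones. The second half follows from the first unless the simplices are single vertices,
  where \<open>P\<close> may be empty.
\<close>

definition consistent :: "nat set \<Rightarrow> nat list set \<Rightarrow> nat set \<Rightarrow> nat list set \<Rightarrow> bool" where
  "consistent \<tau> P \<tau>' P' \<longleftrightarrow>
     (\<forall>v \<in> \<tau> - \<tau>'. \<forall>w \<in> \<tau>' - \<tau>. \<forall>xs \<in> permutations_of_set \<tau>.
        xs \<in> P \<longleftrightarrow> map (id(v := w)) xs \<notin> P')"

definition orientable :: "nat \<Rightarrow> nat set set \<Rightarrow> bool" where
  "orientable d \<Gamma> \<longleftrightarrow>
     (\<exists>P. (\<forall>\<tau>\<in>\<Gamma>. orientation \<tau> (P \<tau>)) \<and>
        (\<forall>\<tau>\<in>\<Gamma>. \<forall>\<tau>'\<in>\<Gamma>. adjacent d \<tau> \<tau>' \<longrightarrow> consistent \<tau> (P \<tau>) \<tau>' (P \<tau>')))"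

end

theory Submission
  imports Defs "HOL-Library.Indicator_Function"
begin

text \<open>
  For an ordering \<open>xs\<close> of a facet, prepend an entry \<open>w v\<close> to the column of \<open>C\<close> at each vertex \<open>v\<close>
  and take the determinant. It is alternating in \<open>xs\<close>, and its coefficient at \<open>w v\<close> depends only
  on the columns of \<open>C\<close> at the other vertices. The facet is positively spanning iff these
  coefficients have one common nonzero sign, which is then the sign of the determinant for
  \<open>w = 1\<close>. Hence replacing \<open>v\<close> by the vertex \<open>v'\<close> of an adjacent facet preserves this sign, while
  consistent orientations are reversed: comparing the sign with the orientation gives the
  2-colouring. Conversely, a balanced colouring \<open>\<gamma>\<close> is turned into a decoration by giving the
  colours the columns \<open>e\<^sub>1, \<dots>, e\<^sub>d\<close> and \<open>- (e\<^sub>1 + \<dots> + e\<^sub>d)\<close>.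
\<close>

section \<open>Determinants weighted along an ordering\<close>

text \<open>The matrix is transposed, so that vertices index rows; vertex \<open>v\<close> is column \<open>v - 1\<close> of \<open>C\<close>.\<close>

definition weighted_matrix :: "real mat \<Rightarrow> (nat \<Rightarrow> real) \<Rightarrow> nat list \<Rightarrow> real mat" where
  "weighted_matrix C w xs = mat (length xs) (length xs)
     (\<lambda>(i, j). if j = 0 then w (xs ! i) else C $$ (j - 1, xs ! i - 1))"

definition weighted_det :: "real mat \<Rightarrow> (nat \<Rightarrow> real) \<Rightarrow> nat list \<Rightarrow> real" where
  "weighted_det C w xs = det (weighted_matrix C w xs)"

text \<open>The cofactor of the weight entry in row \<open>k\<close>. The index shift skips position
  \<open>k\<close>, so neither \<open>w\<close> nor the vertex \<open>xs ! k\<close> enters.\<close>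

definition weight_cofactor :: "real mat \<Rightarrow> nat list \<Rightarrow> nat \<Rightarrow> real" where
  "weight_cofactor C xs k = (-1) ^ k * det (mat (length xs - 1) (length xs - 1)
     (\<lambda>(i, j). C $$ (j, xs ! (if i < k then i else Suc i) - 1)))"

lemma weighted_matrix_carrier [simp]:
  "weighted_matrix C w xs \<in> carrier_mat (length xs) (length xs)"
  by (simp add: weighted_matrix_def)

text \<open>Laplace expansion along column 0, the only column that carries \<open>w\<close>; it
  exists because \<open>xs\<close> is nonempty.\<close>

lemma weighted_det_laplace:
  assumes "xs \<noteq> []"
  shows "weighted_det C w xs = (\<Sum>k<length xs. w (xs ! k) * weight_cofactor C xs k)"
proof -
  have "weighted_det C w xs = (\<Sum>k<length xs. weighted_matrix C w xs $$ (k, 0)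
      * cofactor (weighted_matrix C w xs) k 0)"
    unfolding weighted_det_def
    by (rule laplace_expansion_column) (use assms in auto)
  also have "\<dots> = (\<Sum>k<length xs. w (xs ! k) * weight_cofactor C xs k)"
  proof (rule sum.cong)
    fix k assume k: "k \<in> {..<length xs}"
    have "mat_delete (weighted_matrix C w xs) k 0 = mat (length xs - 1) (length xs - 1)
        (\<lambda>(i, j). C $$ (j, xs ! (if i < k then i else Suc i) - 1))"
      by (rule eq_matI) (use k in \<open>auto simp: mat_delete_def weighted_matrix_def\<close>)
    then show "weighted_matrix C w xs $$ (k, 0) * cofactor (weighted_matrix C w xs) k 0
        = w (xs ! k) * weight_cofactor C xs k"
      using k assms by (auto simp: cofactor_def weight_cofactor_def weighted_matrix_def)
  qed simp
  finally show ?thesis .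
qed

text \<open>Row \<open>i\<close> depends only on the vertex \<open>xs ! i\<close>, so reordering the
  vertices permutes the rows.\<close>

lemma weighted_det_permute:
  assumes p: "p permutes {..<length xs}"
  shows "weighted_det C w (permute_list p xs) = of_int (sign p) * weighted_det C w xs"
proof -
  have "weighted_matrix C w (permute_list p xs)
      = mat (length xs) (length xs) (\<lambda>(i, j). weighted_matrix C w xs $$ (p i, j))"
    by (rule eq_matI)
      (use permutes_in_image[OF p] in \<open>auto simp: weighted_matrix_def permute_list_nth[OF p]\<close>)
  then show ?thesis
    unfolding weighted_det_def
    using det_permute_rows[OF weighted_matrix_carrier, of p xs C w] p
    by (simp add: lessThan_atLeast0)
qed

lemma permutations_of_set_permute_list:
  assumes "xs \<in> permutations_of_set A" "ys \<in> permutations_of_set A"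
  obtains p where "p permutes {..<length xs}" "permute_list p xs = ys"
proof -
  have "mset ys = mset xs"
    using assms by (auto simp: permutations_of_set_def set_eq_iff_mset_eq_distinct)
  then show ?thesis using that by (rule mset_eq_permutation)
qed

text \<open>Names a coefficient by its vertex rather than its position, which allows different
  orderings of one facet to be compared.\<close>

lemma weighted_det_indicator:
  assumes "distinct xs" "k < length xs"
  shows "weighted_det C (indicator {xs ! k}) xs = weight_cofactor C xs k"
proof -
  have "weighted_det C (indicator {xs ! k}) xs
      = (\<Sum>i<length xs. indicator {xs ! k} (xs ! i) * weight_cofactor C xs i)"
    by (rule weighted_det_laplace) (use assms in auto)
  also have "\<dots> = (\<Sum>i<length xs. if i = k then weight_cofactor C xs i else 0)"
    by (rule sum.cong) (use assms in \<open>auto simp: indicator_def nth_eq_iff_index_eq\<close>)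
  finally show ?thesis using assms(2) by simp
qed

text \<open>Position \<open>k\<close> is never read. This is what two adjacent facets have in
  common.\<close>

lemma weight_cofactor_update:
  "weight_cofactor C (xs[k := w]) k = weight_cofactor C xs k"
proof -
  have "mat (length xs - 1) (length xs - 1)
        (\<lambda>(i, j). C $$ (j, xs[k := w] ! (if i < k then i else Suc i) - 1))
      = mat (length xs - 1) (length xs - 1)
        (\<lambda>(i, j). C $$ (j, xs ! (if i < k then i else Suc i) - 1))"
    by (rule eq_matI) auto
  then show ?thesis by (simp add: weight_cofactor_def)
qed

text \<open>Links the vertex replacement used in \<open>consistent\<close> to an update at one
  position.\<close>

lemma map_fun_upd_id_eq_list_update:
  assumes "distinct xs" "k < length xs"
  shows "map (id(xs ! k := w)) xs = xs[k := w]"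
  by (rule nth_equalityI) (use assms in \<open>auto simp: nth_list_update nth_eq_iff_index_eq\<close>)

section \<open>Positive spanning in terms of weighted determinants\<close>

lemma minor_eq:
  assumes M: "M \<in> carrier_mat d (Suc d)" and k: "k \<le> d"
  shows "minor M (Suc k) = det (mat d d (\<lambda>(i, j). M $$ (i, if j < k then j else Suc j)))"
proof -
  have pick: "pick {j. j \<noteq> k} j = (if j < k then j else Suc j)" for j
  proof -
    let ?m = "if j < k then j else Suc j"
    \<comment> \<open>An element of a set is picked at the index given by its rank: exactly
      \<open>j\<close> numbers other than \<open>k\<close> lie below \<open>?m\<close>.\<close>
    have "{a \<in> {j. j \<noteq> k}. a < ?m} = (if j < k then {..<j} else {..<Suc j} - {k})" by auto
    then have "card {a \<in> {j. j \<noteq> k}. a < ?m} = j" by simp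
    then show ?thesis using pick_card_in_set[of ?m "{j. j \<noteq> k}"] by simp
  qed
  have "{j. j < Suc d \<and> j \<noteq> k} = {..<Suc d} - {k}" by auto
  then have c: "card {j. j < Suc d \<and> j \<noteq> k} = d" using k by simp
  have "submatrix M UNIV {j. Suc j \<noteq> Suc k}
      = mat d d (\<lambda>(i, j). M $$ (i, if j < k then j else Suc j))"
    unfolding submatrix_def using M c by (auto simp: pick pick_UNIV)
  then show ?thesis by (simp add: minor_def)
qed

lemma column_submatrix_enumeration:
  assumes C: "C \<in> carrier_mat d n" and sub: "\<tau> \<subseteq> {1..n}"
  obtains xs where "xs \<in> permutations_of_set \<tau>"
    "column_submatrix C \<tau> = mat d (card \<tau>) (\<lambda>(i, j). C $$ (i, xs ! j - 1))"
proof
  let ?S = "{j. Suc j \<in> \<tau>}"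
  \<comment> \<open>The increasing enumeration of the facet; \<open>Suc\<close> turns the column
    index, counted from 0, back into a vertex.\<close>
  define xs where "xs = map (\<lambda>i. Suc (pick ?S i)) [0..<card \<tau>]"
  have fin: "finite \<tau>" using sub finite_subset by blast
  have img: "Suc ` ?S = \<tau>" using sub by (force simp: image_iff intro: Suc_pred')
  then have cS: "card ?S = card \<tau>" by (metis card_image inj_Suc)
  have inj: "inj_on (pick ?S) {0..<card \<tau>}"
    by (rule inj_onI) (metis atLeastLessThan_iff cS nat_neq_iff pick_mono_le)
  have d: "distinct xs" using inj by (auto simp: xs_def distinct_map inj_on_def)
  have "set xs \<subseteq> \<tau>" using pick_in_set_le[of _ ?S] cS by (auto simp: xs_def)
  moreover have "card (set xs) = card \<tau>" using distinct_card[OF d] by (metis diff_zero length_map length_upt xs_def)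
  ultimately have "set xs = \<tau>" using fin by (simp add: card_subset_eq)
  with d show "xs \<in> permutations_of_set \<tau>" by (simp add: permutations_of_set_def)
  \<comment> \<open>\<open>submatrix\<close> counts only indices below the number of columns; none
    is lost because \<tau> lies in \<open>{1..n}\<close>.\<close>
  have "{j. j < n \<and> Suc j \<in> \<tau>} = ?S" using sub by auto
  then have cn: "card {j. j < n \<and> Suc j \<in> \<tau>} = card \<tau>" by (simp only: cS)
  show "column_submatrix C \<tau> = mat d (card \<tau>) (\<lambda>(i, j). C $$ (i, xs ! j - 1))"
    unfolding column_submatrix_def submatrix_def
    using C by (intro eq_matI) (simp_all add: cn pick_UNIV xs_def)
qed

text \<open>The two matrices are transposes of each other, and the second factor
  \<open>(-1) ^ k\<close> cancels the sign built into \<open>weight_cofactor\<close>.\<close>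

lemma minor_column_enumeration:
  assumes "length xs = Suc d" "k \<le> d"
  shows "minor (mat d (Suc d) (\<lambda>(i, j). C $$ (i, xs ! j - 1))) (Suc k)
    = (-1) ^ k * weight_cofactor C xs k"
proof -
  let ?A = "mat d d (\<lambda>(i, j). C $$ (j, xs ! (if i < k then i else Suc i) - 1))"
  have "minor (mat d (Suc d) (\<lambda>(i, j). C $$ (i, xs ! j - 1))) (Suc k) = det (transpose_mat ?A)"
    unfolding minor_eq[OF mat_carrier assms(2)]
    by (rule arg_cong[where f = det], rule eq_matI) (use assms in auto)
  also have "\<dots> = det ?A" by (rule det_transpose) auto
  finally show ?thesis
    using assms by (simp add: weight_cofactor_def flip: mult.assoc power_add mult_2)
qed

text \<open>Minors refer to the increasing ordering. Any other ordering multiplies all coefficients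
  by the same sign, so having a common nonzero sign does not depend on the ordering.\<close>

lemma positively_spanning_iff:
  assumes C: "C \<in> carrier_mat d n" and sub: "\<tau> \<subseteq> {1..n}" and card: "card \<tau> = Suc d"
    and xs: "xs \<in> permutations_of_set \<tau>"
  shows "positively_spanning d (column_submatrix C \<tau>)
    \<longleftrightarrow> (\<exists>s. s \<noteq> 0 \<and> (\<forall>v\<in>\<tau>. sgn (weighted_det C (indicator {v}) xs) = s))"
proof -
  obtain ys where ys: "ys \<in> permutations_of_set \<tau>"
    and M: "column_submatrix C \<tau> = mat d (Suc d) (\<lambda>(i, j). C $$ (i, ys ! j - 1))"
    using column_submatrix_enumeration[OF C sub] card by metis
  have len: "length ys = Suc d" and dist: "distinct ys" and set: "set ys = \<tau>"
    using ys card by (auto simp: permutations_of_set_def distinct_card)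
  \<comment> \<open>Counting columns from 1 leaves a global factor -1, which does not affect whether
    the signs agree.\<close>
  have minor: "(-1) ^ Suc k * minor (column_submatrix C \<tau>) (Suc k) = - weight_cofactor C ys k"
    if "k \<le> d" for k
    using minor_column_enumeration[OF len that] unfolding M
    by (simp flip: mult.assoc power_add mult_2)
  have ball: "(\<forall>i\<in>{1..d + 1}. Q i) \<longleftrightarrow> (\<forall>k\<le>d. Q (Suc k))" for Q
    by (metis Suc_eq_plus1 Suc_le_D Suc_le_mono atLeastAtMost_iff le_add2 One_nat_def)
  have "positively_spanning d (column_submatrix C \<tau>) \<longleftrightarrow>
      (\<forall>k\<le>d. weight_cofactor C ys k \<noteq> 0) \<and>
      (\<forall>k\<le>d. \<forall>l\<le>d. sgn (weight_cofactor C ys k) = sgn (weight_cofactor C ys l))"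
    unfolding positively_spanning_def ball using minor by (simp add: M sgn_minus)
  also have "\<dots> \<longleftrightarrow> (\<exists>s. s \<noteq> 0 \<and> (\<forall>k\<le>d. sgn (weight_cofactor C ys k) = s))"
    by (metis le0 sgn_eq_0_iff)
  also have "\<dots> \<longleftrightarrow> (\<exists>s. s \<noteq> 0 \<and> (\<forall>v\<in>\<tau>. sgn (weighted_det C (indicator {v}) ys) = s))"
    unfolding set[symmetric] all_set_conv_all_nth len less_Suc_eq_le
    using weighted_det_indicator[OF dist] len by (simp add: less_Suc_eq_le)
  also have "\<dots> \<longleftrightarrow> (\<exists>s. s \<noteq> 0 \<and> (\<forall>v\<in>\<tau>. sgn (weighted_det C (indicator {v}) xs) = s))"
  proof -
    obtain p where p: "p permutes {..<length xs}" "permute_list p xs = ys"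
      using permutations_of_set_permute_list[OF xs ys] .
    have "weighted_det C w ys = of_int (sign p) * weighted_det C w xs" for w
      using weighted_det_permute[OF p(1)] p(2) by metis
    then show ?thesis
      \<comment> \<open>For odd \<open>p\<close> the witness \<open>s\<close> becomes
        \<open>- s\<close>.\<close>
      by (cases p rule: sign_cases) (simp_all add: sgn_minus, metis add.inverse_inverse neg_equal_0_iff_equal)
  qed
  finally show ?thesis .
qed

text \<open>With all weights 1 the determinant is the sum of the coefficients; as they share one
  nonzero sign, nothing cancels.\<close>

lemma positively_spanning_weighted_det:
  assumes C: "C \<in> carrier_mat d n" and sub: "\<tau> \<subseteq> {1..n}" and card: "card \<tau> = Suc d"
    and span: "positively_spanning d (column_submatrix C \<tau>)"
    and xs: "xs \<in> permutations_of_set \<tau>" and k: "k < length xs"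
  shows "weighted_det C (\<lambda>_. 1) xs \<noteq> 0"
    and "sgn (weighted_det C (\<lambda>_. 1) xs) = sgn (weight_cofactor C xs k)"
proof -
  have len: "length xs = Suc d" and dist: "distinct xs" and set: "set xs = \<tau>"
    using xs card by (auto simp: permutations_of_set_def distinct_card)
  obtain s where s: "s \<noteq> 0" "\<forall>v\<in>\<tau>. sgn (weighted_det C (indicator {v}) xs) = s"
    using span positively_spanning_iff[OF C sub card xs] by blast
  have cof: "sgn (weight_cofactor C xs i) = s" if "i < length xs" for i
    using s(2) weighted_det_indicator[OF dist that, of C] that set by (metis nth_mem)
  have sum: "weighted_det C (\<lambda>_. 1) xs = (\<Sum>i<length xs. weight_cofactor C xs i)"
    using weighted_det_laplace[of xs C "\<lambda>_. 1"] len by fastforce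
  have ne: "{..<length xs} \<noteq> {}" using k by auto
  have "sgn (weighted_det C (\<lambda>_. 1) xs) = s"
  proof (cases "s > 0")
    case True
    then have "weight_cofactor C xs i > 0" if "i < length xs" for i
      using cof[OF that] by (metis sgn_greater)
    then have "weighted_det C (\<lambda>_. 1) xs > 0" unfolding sum using ne by (intro sum_pos) auto
    then show ?thesis using cof[OF k] True by (metis sgn_greater sgn_pos)
  next
    case False
    then have "- weight_cofactor C xs i > 0" if "i < length xs" for i
      using cof[OF that] s(1) by (metis linorder_neqE_linordered_idom neg_0_less_iff_less sgn_less)
    then have "(\<Sum>i<length xs. - weight_cofactor C xs i) > 0" using ne by (intro sum_pos) auto
    then have "weighted_det C (\<lambda>_. 1) xs < 0" unfolding sum by (simp add: sum_negf)
    then show ?thesis using cof[OF k] False s(1)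
      by (metis linorder_neqE_linordered_idom sgn_less sgn_neg)
  qed
  then show "weighted_det C (\<lambda>_. 1) xs \<noteq> 0"
    and "sgn (weighted_det C (\<lambda>_. 1) xs) = sgn (weight_cofactor C xs k)"
    using s(1) cof[OF k] by auto
qed

section \<open>From balanced to positively decorable\<close>

lemma balanced_imp_positively_decorable:
  assumes pure: "pure_complex n d \<Gamma>" and bal: "balanced n d \<Gamma>"
  shows "positively_decorable n d \<Gamma>"
proof -
  obtain \<gamma> where rng: "\<gamma> ` {1..n} \<subseteq> {1..d + 1}"
    and col: "\<And>a b. {a, b} \<in> edges \<Gamma> \<Longrightarrow> \<gamma> a \<noteq> \<gamma> b"
    using bal by (auto simp: balanced_def)
  \<comment> \<open>Column \<open>j\<close> belongs to vertex \<open>Suc j\<close>. Colours 1 to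
    \<open>d\<close> give unit vectors, colour \<open>Suc d\<close> the vector with all entries
    -1.\<close>
  define C where "C = mat d n (\<lambda>(i, j). if \<gamma> (Suc j) = Suc i then 1
    else if \<gamma> (Suc j) = Suc d then -1 else 0 :: real)"
  have C: "C \<in> carrier_mat d n" by (simp add: C_def)
  have "positively_spanning d (column_submatrix C \<tau>)" if \<tau>: "\<tau> \<in> \<Gamma>" for \<tau>
  proof -
    have sub: "\<tau> \<subseteq> {1..n}" and card: "card \<tau> = Suc d"
      using pure \<tau> by (auto simp: pure_complex_def)
    have inj: "inj_on \<gamma> \<tau>"
    proof (rule inj_onI, rule ccontr)
      fix a b assume "a \<in> \<tau>" "b \<in> \<tau>" "\<gamma> a = \<gamma> b" "a \<noteq> b"
      then have "{a, b} \<in> edges \<Gamma>" using \<tau> by (auto simp: edges_def)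
      then show False using col \<open>\<gamma> a = \<gamma> b\<close> by blast
    qed
    \<comment> \<open>Any two vertices of a facet form an edge, so the colouring is injective there
      and uses every colour once.\<close>
    have img: "\<gamma> ` \<tau> = {1..Suc d}"
      by (rule card_subset_eq) (use rng sub card card_image[OF inj] in auto)
    \<comment> \<open>Listing the vertices by colour turns the columns of the facet into an identity
      matrix followed by a column of -1.\<close>
    define xs where "xs = map (inv_into \<tau> \<gamma>) [1..<Suc (Suc d)]"
    have len: "length xs = Suc d" by (simp add: xs_def)
    have set: "set xs = \<tau>"
      using inv_into_image_cancel[OF inj subset_refl] img
      by (simp add: xs_def atLeastLessThanSuc_atLeastAtMost del: upt_Suc)
    have dist: "distinct xs" using set len card by (simp add: card_distinct)
    have xs: "xs \<in> permutations_of_set \<tau>" using set dist by (simp add: permutations_of_set_def)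
    have \<gamma>_xs: "\<gamma> (xs ! i) = Suc i" if "i < Suc d" for i
      using that img by (simp add: xs_def f_inv_into_f del: upt_Suc)
    have C_xs: "C $$ (j, xs ! i - 1) = (if i = j then 1 else if i = d then -1 else 0)"
      if "i < Suc d" "j < d" for i j
    proof -
      have "xs ! i \<in> {1..n}" using that len set sub by (metis nth_mem subsetD)
      then show ?thesis using that \<gamma>_xs[OF that(1)] by (auto simp: C_def)
    qed
    have last: "weight_cofactor C xs d \<noteq> 0"
    proof -
      have "mat d d (\<lambda>(i, j). C $$ (j, xs ! (if i < d then i else Suc i) - 1)) = 1\<^sub>m d"
        by (rule eq_matI) (auto simp: C_xs[simplified])
      then show ?thesis by (simp add: weight_cofactor_def len)
    qed
    have "weight_cofactor C xs j = weight_cofactor C xs d" if "j < Suc d" for j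
    proof (cases "j = d")
      case False
      then have j: "j < d" using that by simp
      \<comment> \<open>Weighting by a row of \<open>C\<close> duplicates a column.\<close>
      let ?w = "\<lambda>x. C $$ (j, x - 1)"
      have "weighted_det C ?w xs = 0"
        unfolding weighted_det_def
        by (rule det_identical_columns[of _ "length xs" 0 "Suc j"])
          (use j len in \<open>auto simp: weighted_matrix_def\<close>)
      then have "(\<Sum>k<Suc d. ?w (xs ! k) * weight_cofactor C xs k) = 0"
        using weighted_det_laplace[of xs C ?w] len by fastforce
      \<comment> \<open>Along \<open>xs\<close>, row \<open>j\<close> of \<open>C\<close> is 1 at
        position \<open>j\<close>, -1 at position \<open>d\<close> and 0 elsewhere, so the vanishing
        expansion is a difference of two coefficients.\<close>
      moreover have "(\<Sum>k<Suc d. ?w (xs ! k) * weight_cofactor C xs k)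
          = (\<Sum>k<d. if k = j then weight_cofactor C xs k else 0) - weight_cofactor C xs d"
      proof -
        have "(\<Sum>k<d. ?w (xs ! k) * weight_cofactor C xs k)
            = (\<Sum>k<d. if k = j then weight_cofactor C xs k else 0)"
          by (rule sum.cong) (use j in \<open>auto simp: C_xs[simplified]\<close>)
        then show ?thesis using j by (simp add: C_xs[simplified])
      qed
      ultimately show ?thesis using j by simp
    qed simp
    then have "sgn (weighted_det C (indicator {v}) xs) = sgn (weight_cofactor C xs d)"
      if "v \<in> \<tau>" for v
      using that weighted_det_indicator[OF dist] len unfolding set[symmetric]
      by (metis in_set_conv_nth)
    then show ?thesis
      unfolding positively_spanning_iff[OF C sub card xs] using last by (metis sgn_eq_0_iff)
  qed
  then show ?thesis using C by (auto simp: positively_decorable_def)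
qed

section \<open>From positively decorable to bipartite\<close>

lemma positively_decorable_orientable_imp_bipartite:
  assumes pure: "pure_complex n d \<Gamma>" and ori: "orientable d \<Gamma>"
    and dec: "positively_decorable n d \<Gamma>"
  shows "bipartite d \<Gamma>"
proof -
  obtain C where C: "C \<in> carrier_mat d n"
    and span: "\<And>\<tau>. \<tau> \<in> \<Gamma> \<Longrightarrow> positively_spanning d (column_submatrix C \<tau>)"
    using dec by (auto simp: positively_decorable_def)
  obtain P where P: "\<And>\<tau>. \<tau> \<in> \<Gamma> \<Longrightarrow> orientation \<tau> (P \<tau>)"
    and cons: "\<And>\<tau> \<tau>'. \<tau> \<in> \<Gamma> \<Longrightarrow> \<tau>' \<in> \<Gamma> \<Longrightarrow> adjacent d \<tau> \<tau>' \<Longrightarrow> consistent \<tau> (P \<tau>) \<tau>' (P \<tau>')"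
    using ori by (auto simp: orientable_def)
  have sub: "\<tau> \<subseteq> {1..n}" and card: "card \<tau> = Suc d" and fin: "finite \<tau>" if "\<tau> \<in> \<Gamma>" for \<tau>
    using pure that finite_subset[of \<tau> "{1..n}"] by (auto simp: pure_complex_def)
  define F where "F = weighted_det C (\<lambda>_. 1)"
  \<comment> \<open>One colour class: the facets whose orientation agrees with the sign of
    \<open>F\<close>.\<close>
  define A where "A = {\<tau> \<in> \<Gamma>. \<forall>xs \<in> permutations_of_set \<tau>. xs \<in> P \<tau> \<longleftrightarrow> F xs > 0}"
  have F_nonzero: "F xs \<noteq> 0" if "\<tau> \<in> \<Gamma>" "xs \<in> permutations_of_set \<tau>" for \<tau> xs
  proof -
    have "length xs = Suc d"
      using that card by (simp add: length_finite_permutations_of_set)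
    then show ?thesis
      using positively_spanning_weighted_det(1)[OF C sub card span, of \<tau> xs 0] that
      by (simp add: F_def)
  qed
  \<comment> \<open>An odd reordering reverses both membership in \<open>P \<tau>\<close> and the
    sign of \<open>F\<close>, an even one neither, so a single ordering decides.\<close>
  have A_iff: "\<tau> \<in> A \<longleftrightarrow> (xs \<in> P \<tau> \<longleftrightarrow> F xs > 0)"
    if \<tau>: "\<tau> \<in> \<Gamma>" and xs: "xs \<in> permutations_of_set \<tau>" for \<tau> xs
  proof -
    have "(ys \<in> P \<tau> \<longleftrightarrow> F ys > 0) \<longleftrightarrow> (xs \<in> P \<tau> \<longleftrightarrow> F xs > 0)"
      if ys: "ys \<in> permutations_of_set \<tau>" for ys
    proof -
      obtain p where p: "p permutes {..<length xs}" "permute_list p xs = ys"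
        using permutations_of_set_permute_list[OF xs ys] .
      have "ys \<in> P \<tau> \<longleftrightarrow> (xs \<in> P \<tau> \<longleftrightarrow> evenperm p)"
        using P[OF \<tau>] xs p by (auto simp: orientation_def)
      moreover have "F ys = (if evenperm p then 1 else -1) * F xs"
        using weighted_det_permute[OF p(1), of C "\<lambda>_. 1"] p(2) by (simp add: F_def sign_def)
      ultimately show ?thesis using F_nonzero[OF \<tau> xs] by (auto split: if_splits)
    qed
    then show ?thesis unfolding A_def using \<tau> xs by blast
  qed
  have flip: "\<tau> \<in> A \<longleftrightarrow> \<tau>' \<notin> A"
    if \<tau>: "\<tau> \<in> \<Gamma>" and \<tau>': "\<tau>' \<in> \<Gamma>" and adj: "adjacent d \<tau> \<tau>'" for \<tau> \<tau>'
  proof -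
    have int: "card (\<tau> \<inter> \<tau>') = d" using adj by (simp add: adjacent_def)
    have "card (\<tau> - \<tau>') = 1" "card (\<tau>' - \<tau>) = 1"
      using card_Diff_subset_Int[of \<tau> \<tau>'] card_Diff_subset_Int[of \<tau>' \<tau>] int card fin \<tau> \<tau>'
      by (simp_all add: Int_commute)
    then obtain v w where v: "\<tau> - \<tau>' = {v}" and w: "\<tau>' - \<tau> = {w}"
      by (auto simp: card_1_singleton_iff)
    obtain xs where xs: "xs \<in> permutations_of_set \<tau>"
      using fin[OF \<tau>] by (metis ex_in_conv permutations_of_set_empty_iff)
    then have set: "set xs = \<tau>" and dist: "distinct xs" by (auto simp: permutations_of_set_def)
    obtain k where k: "k < length xs" "xs ! k = v"
      using v set by (metis DiffD1 in_set_conv_nth singletonI)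
    define ys where "ys = map (id(v := w)) xs"
    have ys_upd: "ys = xs[k := w]"
      using map_fun_upd_id_eq_list_update[OF dist k(1), of w] k(2) by (simp add: ys_def)
    have "id(v := w) ` \<tau> = \<tau>'" using v w by (auto simp: image_iff)
    moreover have "inj_on (id(v := w)) \<tau>" using w by (auto simp: inj_on_def)
    ultimately have ys: "ys \<in> permutations_of_set \<tau>'"
      using set dist by (simp add: ys_def permutations_of_set_def distinct_map)
    \<comment> \<open>Both determinants take the sign of the coefficient at position
      \<open>k\<close>, which the replacement leaves unchanged, whereas consistency reverses
      membership in the orientation.\<close>
    have "sgn (F xs) = sgn (weight_cofactor C xs k)"
      unfolding F_def
      by (rule positively_spanning_weighted_det(2)[OF C sub card span xs k(1)]) fact+
    also have "\<dots> = sgn (weight_cofactor C ys k)"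
      by (simp add: ys_upd weight_cofactor_update)
    also have "\<dots> = sgn (F ys)"
      unfolding F_def
      by (rule positively_spanning_weighted_det(2)[OF C sub card span ys, symmetric])
        (use \<tau>' k in \<open>simp_all add: ys_def\<close>)
    finally have "F xs > 0 \<longleftrightarrow> F ys > 0" by (metis sgn_greater)
    moreover have "xs \<in> P \<tau> \<longleftrightarrow> ys \<notin> P \<tau>'"
      using cons[OF \<tau> \<tau>' adj] v w xs by (auto simp: consistent_def ys_def)
    ultimately show ?thesis using A_iff[OF \<tau> xs] A_iff[OF \<tau>' ys] by blast
  qed
  have "\<exists>a\<in>A. \<exists>b\<in>\<Gamma> - A. e = {a, b}" if e: "e \<in> adjacency_edges d \<Gamma>" for e
  proof -
    obtain \<tau> \<tau>' where e: "e = {\<tau>, \<tau>'}" and \<tau>: "\<tau> \<in> \<Gamma>" and \<tau>': "\<tau>' \<in> \<Gamma>"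
      and adj: "adjacent d \<tau> \<tau>'"
      using e unfolding adjacency_edges_def mem_Collect_eq by (elim exE conjE)
    show ?thesis
    proof (cases "\<tau> \<in> A")
      case True
      with flip[OF \<tau> \<tau>' adj] \<tau>' have "\<tau>' \<in> \<Gamma> - A" by simp
      with True e show ?thesis by (intro bexI)
    next
      case False
      with flip[OF \<tau> \<tau>' adj] have "\<tau>' \<in> A" by simp
      moreover have "\<tau> \<in> \<Gamma> - A" using False \<tau> by simp
      moreover have "e = {\<tau>', \<tau>}" unfolding e by (rule insert_commute)
      ultimately show ?thesis by (intro bexI)
    qed
  qed
  moreover have "A \<union> (\<Gamma> - A) = \<Gamma>" by (auto simp: A_def)
  ultimately show ?thesis unfolding bipartite_def bipartite_graph_def
    by (intro exI[of _ A] exI[of _ "\<Gamma> - A"]) auto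
qed

theorem theorem5:
  fixes n d :: nat and \<Gamma> :: "nat set set"
  assumes "pure_complex n d \<Gamma>"
    and "orientable d \<Gamma>"
  shows "(balanced n d \<Gamma> \<longrightarrow> positively_decorable n d \<Gamma>) \<and>
         (positively_decorable n d \<Gamma> \<longrightarrow> bipartite d \<Gamma>)"
  using balanced_imp_positively_decorable positively_decorable_orientable_imp_bipartite assms
  by blast

end
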